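(* Let $m>0$ and let $\Omega_m*\Omega_m$ be the measure on Minkowski space given by $(\Omega_m*\Omega_m)(\Gamma)=\int\chi_{\Gamma}(p+q)\,\Omega_m(dp)\,\Omega_m(dq)$ for relatively compact Borel $\Gamma\subset\mathbf{R}^4$. Then for every relatively compact Borel set $\Gamma\subset\mathbf{R}^4$ $$(\Omega_m*\Omega_m)(\Gamma)=\int_{m'=2m}^{\infty}\sigma(m')\,\Omega_{m'}(\Gamma)\,dm',\qquad \sigma(m')=4\pi m\,Z(m'),\quad Z(s)=\left(\frac{s^2}{4m^2}-1\right)^{1/2}\ (s\ge 2m).$$ That is, the spectrum of $\Omega_m*\Omega_m$ is $\sigma(m')=4\pi mZ(m')$ for $m'\ge2m$ and $0$ otherwise.
   Context: $\mathbf{R}^4$ carries the Minkowski form $p^2=(p^0)^2-(p^1)^2-(p^2)^2-(p^3)^2$, and $\pi(p)=\vec p=(p^1,p^2,p^3)$. For $m>0$ let $\omega_m(\vec p)=(m^2+|\vec p|^2)^{1/2}$, $H_m^{+}=\{p\in\mathbf{R}^4:p^2=m^2,\ p^0>0\}$, and $\Omega_m(\Gamma)=\Omega_m^{+}(\Gamma)=\int_{\pi(\Gamma\cap H_m^{+})}\frac{d\vec p}{\omega_m(\vec p)}$. $\chi_\Gamma$ is the characteristic function of $\Gamma$. *)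

theory Defs
  imports "HOL-Probability.Convolution"
begin

text \<open>
  Minkowski space is \<^typ>\<open>real^4\<close> with coordinates \<open>p $ 0, p $ 1, p $ 2, p $ 3\<close>; in the index
  type \<^typ>\<open>4\<close> the numeral \<open>4\<close> is the same element as \<open>0\<close>, the time index.
\<close>

definition minkowski_sq :: "real^4 \<Rightarrow> real" where
  "minkowski_sq p = (p $ 0)\<^sup>2 - (p $ 1)\<^sup>2 - (p $ 2)\<^sup>2 - (p $ 3)\<^sup>2"

definition spatial :: "real^4 \<Rightarrow> real^3" where
  "spatial p = vector [p $ 1, p $ 2, p $ 3]"

definition omega :: "real \<Rightarrow> real^3 \<Rightarrow> real" where
  "omega m v = sqrt (m\<^sup>2 + (norm v)\<^sup>2)"

definition mass_shell :: "real \<Rightarrow> (real^4) set" where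
  "mass_shell m = {p. minkowski_sq p = m\<^sup>2 \<and> p $ 0 > 0}"

text \<open>
  \<open>measure_of\<close> yields the zero measure when the given set function is not a measure;
  \<open>emeasure_Omega\<close> below shows that this does not happen for \<open>m > 0\<close>.
\<close>

definition Omega :: "real \<Rightarrow> (real^4) measure" where
  "Omega m = measure_of UNIV (sets borel)
     (\<lambda>\<Gamma>. \<integral>\<^sup>+ v \<in> spatial ` (\<Gamma> \<inter> mass_shell m). ennreal (1 / omega m v) \<partial>lborel)"

definition Z :: "real \<Rightarrow> real \<Rightarrow> real" where
  "Z m s = sqrt (s\<^sup>2 / (4 * m\<^sup>2) - 1)"

definition sigma_spec :: "real \<Rightarrow> real \<Rightarrow> real" where
  "sigma_spec m s = (if 2 * m \<le> s then 4 * pi * m * Z m s else 0)"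

definition has_spectrum :: "(real^4) measure \<Rightarrow> (real \<Rightarrow> real) \<Rightarrow> bool" where
  "has_spectrum \<mu> \<sigma> \<longleftrightarrow>
     \<sigma> \<in> borel_measurable borel \<and> (\<forall>s. 0 \<le> \<sigma> s) \<and>
     (\<forall>\<Gamma> \<in> sets borel. compact (closure \<Gamma>) \<longrightarrow>
        emeasure \<mu> \<Gamma> = (\<integral>\<^sup>+ s \<in> {0<..}. ennreal (\<sigma> s) * emeasure (Omega s) \<Gamma> \<partial>lborel))"

lemma sets_Omega [simp, measurable_cong]: "sets (Omega m) = sets borel"
  unfolding Omega_def using sets.sigma_sets_eq[of "borel :: (real^4) measure"]
  by (subst sets_measure_of) (auto simp: space_borel)

lemma space_Omega [simp]: "space (Omega m) = UNIV"
  unfolding Omega_def by (rule space_measure_of) auto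

lemma UNIV_4_zero: "(UNIV :: 4 set) = {0, 1, 2, 3}"
  unfolding UNIV_4 by force

lemma spatial_nth [simp]: "spatial p $ 1 = p $ 1" "spatial p $ 2 = p $ 2" "spatial p $ 3 = p $ 3"
  by (simp_all add: spatial_def)

lemma norm_real3_sq: "(norm (v :: real^3))\<^sup>2 = (v $ 1)\<^sup>2 + (v $ 2)\<^sup>2 + (v $ 3)\<^sup>2"
  by (simp add: norm_vec_def L2_set_def sum_3)

lemma omega_pos: "m > 0 \<Longrightarrow> omega m v > 0"
  unfolding omega_def by (intro real_sqrt_gt_zero add_pos_nonneg) auto

lemma borel_measurable_omega [measurable]: "omega m \<in> borel_measurable borel"
  unfolding omega_def by measurable

definition lift_shell :: "real \<Rightarrow> real^3 \<Rightarrow> real^4" where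
  "lift_shell m v = (\<chi> i. if i = 0 then omega m v else if i = 1 then v $ 1
                          else if i = 2 then v $ 2 else v $ 3)"

lemma lift_shell_nth [simp]:
  "lift_shell m v $ 0 = omega m v" "lift_shell m v $ 1 = v $ 1"
  "lift_shell m v $ 2 = v $ 2" "lift_shell m v $ 3 = v $ 3"
  by (simp_all add: lift_shell_def)

lemma lift_shell_measurable [measurable]: "lift_shell m \<in> borel_measurable borel"
proof -
  have "continuous_on UNIV (lift_shell m)"
    unfolding lift_shell_def omega_def
  proof (rule continuous_on_vec_lambda)
    fix i :: 4
    show "continuous_on UNIV (\<lambda>v::real^3. if i = 0 then sqrt (m\<^sup>2 + (norm v)\<^sup>2) else if i = 1 then v $ 1
                          else if i = 2 then v $ 2 else v $ 3)"
      by (cases "i = 0"; cases "i = 1"; cases "i = 2") (auto intro!: continuous_intros)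
  qed
  then show ?thesis by (rule borel_measurable_continuous_onI)
qed

lemma spatial_lift_shell [simp]: "spatial (lift_shell m v) = v"
  by (simp add: vec_eq_iff forall_3)

lemma lift_shell_in_shell: "m > 0 \<Longrightarrow> lift_shell m v \<in> mass_shell m"
  using omega_pos[of m v]
  by (simp add: mass_shell_def minkowski_sq_def omega_def norm_real3_sq)

lemma lift_shell_spatial:
  assumes "p \<in> mass_shell m"
  shows "lift_shell m (spatial p) = p"
proof -
  have "m\<^sup>2 + (norm (spatial p))\<^sup>2 = (p $ 0)\<^sup>2"
    using assms by (auto simp: norm_real3_sq mass_shell_def minkowski_sq_def)
  then have "omega m (spatial p) = sqrt ((p $ 0)\<^sup>2)"
    by (simp only: omega_def)
  also have "\<dots> = p $ 0"
    using assms by (simp add: mass_shell_def)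
  finally have *: "omega m (spatial p) = p $ 0" .
  have "lift_shell m (spatial p) $ i = p $ i" for i
  proof -
    have "i \<in> {0, 1, 2, 3}" using UNIV_4_zero by blast
    then show ?thesis using * by auto
  qed
  then show ?thesis by (simp add: vec_eq_iff)
qed

lemma spatial_image_eq:
  assumes "m > 0"
  shows "spatial ` (\<Gamma> \<inter> mass_shell m) = lift_shell m -` \<Gamma>"
proof (intro equalityI subsetI)
  fix v assume "v \<in> spatial ` (\<Gamma> \<inter> mass_shell m)"
  then show "v \<in> lift_shell m -` \<Gamma>" by (auto simp: lift_shell_spatial)
next
  fix v assume "v \<in> lift_shell m -` \<Gamma>"
  then have "lift_shell m v \<in> \<Gamma> \<inter> mass_shell m"
    using lift_shell_in_shell[OF assms] by auto
  then show "v \<in> spatial ` (\<Gamma> \<inter> mass_shell m)"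
    by (metis image_eqI spatial_lift_shell)
qed

lemma Omega_eq_distr:
  assumes "m > 0"
  shows "Omega m = distr (density lborel (\<lambda>v. ennreal (1 / omega m v))) borel (lift_shell m)"
    (is "_ = ?D")
proof -
  have eq: "emeasure ?D \<Gamma> = (\<integral>\<^sup>+ v \<in> spatial ` (\<Gamma> \<inter> mass_shell m). ennreal (1 / omega m v) \<partial>lborel)"
    if "\<Gamma> \<in> sets borel" for \<Gamma>
  proof -
    have "lift_shell m -` \<Gamma> \<in> sets borel"
      using measurable_sets[OF lift_shell_measurable that] by simp
    then show ?thesis
      using that by (simp add: emeasure_distr emeasure_density spatial_image_eq[OF assms])
  qed
  have "?D = measure_of (space ?D) (sets ?D) (emeasure ?D)"
    by (rule measure_of_of_measure[symmetric])
  also have "\<dots> = Omega m"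
    unfolding Omega_def space_distr sets_distr space_borel
    by (rule measure_of_eq)
       (use eq sets.sigma_sets_eq[of "borel :: (real^4) measure"] in \<open>auto simp: space_borel\<close>)
  finally show ?thesis by simp
qed

lemma emeasure_Omega:
  assumes "m > 0" "\<Gamma> \<in> sets borel"
  shows "emeasure (Omega m) \<Gamma> =
     (\<integral>\<^sup>+ v \<in> spatial ` (\<Gamma> \<inter> mass_shell m). ennreal (1 / omega m v) \<partial>lborel)"
proof -
  have "lift_shell m -` \<Gamma> \<in> sets borel"
    using measurable_sets[OF lift_shell_measurable assms(2)] by simp
  then show ?thesis
    using assms by (simp add: Omega_eq_distr emeasure_distr emeasure_density spatial_image_eq)
qed

lemma emeasure_Omega_bounded:
  assumes "m > 0" "\<Gamma> \<in> sets borel" "bounded \<Gamma>"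
  shows "emeasure (Omega m) \<Gamma> < \<infinity>"
proof -
  obtain B where B: "\<And>p. p \<in> \<Gamma> \<Longrightarrow> norm p \<le> B"
    using assms(3) unfolding bounded_iff by blast
  have sub: "lift_shell m -` \<Gamma> \<subseteq> cball 0 B"
  proof
    fix v assume "v \<in> lift_shell m -` \<Gamma>"
    then have "norm (lift_shell m v) \<le> B" using B by auto
    moreover have "norm v \<le> omega m v"
      unfolding omega_def by (rule real_le_rsqrt) simp
    moreover have "\<bar>lift_shell m v $ 0\<bar> \<le> norm (lift_shell m v)"
      by (rule component_le_norm_cart)
    ultimately show "v \<in> cball 0 B" by simp
  qed
  have om: "1 / omega m v \<le> 1 / m" for v
  proof -
    have "m \<le> omega m v" unfolding omega_def using assms(1) by (intro real_le_rsqrt) simp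
    then show ?thesis using assms(1) by (simp add: frac_le)
  qed
  have "emeasure (Omega m) \<Gamma> = (\<integral>\<^sup>+ v. ennreal (1 / omega m v) * indicator (lift_shell m -` \<Gamma>) v \<partial>lborel)"
    using assms by (simp add: emeasure_Omega spatial_image_eq)
  also have "\<dots> \<le> (\<integral>\<^sup>+ v. ennreal (1 / m) * indicator (cball (0 :: real^3) B) v \<partial>lborel)"
  proof (rule nn_integral_mono)
    fix v
    show "ennreal (1 / omega m v) * indicator (lift_shell m -` \<Gamma>) v \<le> ennreal (1 / m) * indicator (cball 0 B) v"
      using sub om[of v] by (intro mult_mono) (auto simp: ennreal_leI split: split_indicator)
  qed
  also have "\<dots> = ennreal (1 / m) * emeasure lborel (cball (0 :: real^3) B)"
    by (simp add: nn_integral_cmult_indicator)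
  also have "\<dots> < \<infinity>"
    using emeasure_lborel_cball_finite[of "0 :: real^3" B] by (simp add: ennreal_mult_less_top)
  finally show ?thesis .
qed

lemma sigma_finite_Omega:
  assumes "m > 0"
  shows "sigma_finite_measure (Omega m)"
proof
  show "\<exists>A. countable A \<and> A \<subseteq> sets (Omega m) \<and> \<Union> A = space (Omega m) \<and>
          (\<forall>a\<in>A. emeasure (Omega m) a \<noteq> \<infinity>)"
  proof (intro exI[of _ "range (\<lambda>n::nat. cball 0 (real n))"] conjI)
    have "\<exists>n::nat. norm p \<le> real n" for p :: "real^4" by (rule real_arch_simple)
    then show "\<Union> (range (\<lambda>n::nat. cball 0 (real n))) = space (Omega m)" by auto
    show "\<forall>a\<in>range (\<lambda>n::nat. cball 0 (real n)). emeasure (Omega m) a \<noteq> \<infinity>"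
    proof
      fix a :: "(real^4) set" assume "a \<in> range (\<lambda>n::nat. cball 0 (real n))"
      then have "a \<in> sets borel" "bounded a" by auto
      then show "emeasure (Omega m) a \<noteq> \<infinity>"
        using emeasure_Omega_bounded[OF assms, of a] by auto
    qed
  qed auto
qed

text \<open>The library's convolution is the measure given by the usual double integral here.\<close>

lemma emeasure_convolution_Omega:
  assumes "m > 0" and [measurable]: "\<Gamma> \<in> sets borel"
  shows "emeasure (Omega m \<star> Omega m) \<Gamma> =
     (\<integral>\<^sup>+ p. \<integral>\<^sup>+ q. indicator \<Gamma> (p + q) \<partial>Omega m \<partial>Omega m)"
proof -
  interpret sigma_finite_measure "Omega m" by (rule sigma_finite_Omega[OF assms(1)])
  have "emeasure (Omega m \<star> Omega m) \<Gamma> = (\<integral>\<^sup>+ x. indicator \<Gamma> x \<partial>(Omega m \<star> Omega m))"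
    by (simp add: assms(2))
  also have "\<dots> = (\<integral>\<^sup>+ x. indicator \<Gamma> (fst x + snd x) \<partial>(Omega m \<Otimes>\<^sub>M Omega m))"
    unfolding convolution_def by (subst nn_integral_distr) (auto simp: case_prod_beta)
  also have "\<dots> = (\<integral>\<^sup>+ p. \<integral>\<^sup>+ q. indicator \<Gamma> (p + q) \<partial>Omega m \<partial>Omega m)"
    by (subst nn_integral_fst[symmetric]) auto
  finally show ?thesis .
qed

end

theory Submission
  imports Defs
begin

text \<open>
  Fix the total spatial momentum \<open>u\<close> and put \<open>k = |u|\<close>. Rotating \<open>u\<close> to the first axis and using cylindrical
  coordinates \<open>(x, r)\<close> with \<open>r\<close> the squared distance from that axis, the integral over the momentum of the
  first particle becomes \<open>\<pi> dx dr / (a b)\<close>, where \<open>a\<close>, \<open>b\<close> are the two energies. For fixed \<open>x\<close>, replacing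
  \<open>r\<close> by the invariant mass \<open>s = ((a + b)\<^sup>2 - k\<^sup>2)\<^bsup>1/2\<^esup>\<close> of the pair turns \<open>dr / (a b)\<close> into
  \<open>2 s ds / (s\<^sup>2 + k\<^sup>2)\<close>. For given \<open>s \<ge> 2 m\<close> the admissible \<open>x\<close> form an interval of length
  \<open>((s\<^sup>2 + k\<^sup>2) (1 - 4 m\<^sup>2 / s\<^sup>2))\<^bsup>1/2\<^esup>\<close>, so the density in \<open>s\<close> is \<open>4 \<pi> m Z(s) / \<omega>\<^sub>s(u)\<close>. The factor
  \<open>1 / \<omega>\<^sub>s(u)\<close> is the density of \<open>\<Omega>\<^sub>s\<close>, and \<open>4 \<pi> m Z(s)\<close> remains.
\<close>

section \<open>Changes of variables for the Lebesgue integral\<close>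

text \<open>Monotone convergence from the substitution rule on the compact intervals
  \<open>{0..real n}\<close>. Since \<open>g'\<close> is nonnegative, the image intervals
  \<open>{g 0..g (real n)}\<close> increase, and \<open>lim\<close> makes them exhaust
  \<open>{g 0..}\<close>.\<close>

lemma nn_integral_substitution_atLeast:
  fixes f :: "real \<Rightarrow> ennreal" and g g' :: "real \<Rightarrow> real"
  assumes [measurable]: "f \<in> borel_measurable borel"
    and deriv: "\<And>x. 0 \<le> x \<Longrightarrow> (g has_real_derivative g' x) (at x)"
    and cont: "continuous_on {0..} g'"
    and nonneg: "\<And>x. 0 \<le> x \<Longrightarrow> 0 \<le> g' x"
    and lim: "filterlim g at_top at_top"
  shows "(\<integral>\<^sup>+x\<in>{g 0..}. f x \<partial>lborel) = (\<integral>\<^sup>+x\<in>{0..}. f (g x) * ennreal (g' x) \<partial>lborel)"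
proof -
  have mono: "g x \<le> g y" if "0 \<le> x" "x \<le> y" for x y
  proof (rule DERIV_nonneg_imp_nondecreasing[OF that(2)])
    fix z assume "x \<le> z"
    then have "0 \<le> z" using that by simp
    then show "\<exists>D. (g has_real_derivative D) (at z) \<and> 0 \<le> D" using deriv nonneg by blast
  qed
  have "continuous_on {0..} g"
    using deriv by (intro continuous_at_imp_continuous_on) (auto intro: DERIV_isCont)
  \<comment> \<open>Nothing is known about \<open>g\<close> and \<open>g'\<close> on the negative
    axis, so only their cut-offs to \<open>{0..}\<close> are shown to be measurable;
    \<open>meas\<close> then transfers this to the integrand.\<close>
  then have [measurable]: "(\<lambda>x. g x * indicator {0..} x) \<in> borel_measurable borel"
    by (subst mult.commute)
      (auto simp: borel_measurable_continuous_on_indicator[of "{0..}" g, unfolded real_scaleR_def])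
  have [measurable]: "(\<lambda>x. g' x * indicator {0..} x) \<in> borel_measurable borel"
    using cont by (subst mult.commute)
      (auto simp: borel_measurable_continuous_on_indicator[of "{0..}" g', unfolded real_scaleR_def])
  have meas: "(\<lambda>x. f (g x) * ennreal (g' x) * indicator {0..real n} x) \<in> borel_measurable borel" for n
  proof -
    have "(\<lambda>x. f (g x * indicator {0..} x) * ennreal (g' x * indicator {0..} x) * indicator {0..real n} x)
        \<in> borel_measurable borel" by measurable
    then show ?thesis by (rule measurable_cong[THEN iffD1, rotated]) (auto split: split_indicator)
  qed
  have SUP_ind: "(SUP n. c * indicator (A n) x) = (c * indicator B x :: ennreal)"
    if AB: "\<Union> (range A) = B" for A :: "nat \<Rightarrow> real set" and B c x
  proof (cases "x \<in> B")
    case True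
    then obtain k where "x \<in> A k" using AB by auto
    then have "c \<le> (SUP n. c * indicator (A n) x)"
      by (intro SUP_upper2[of k]) auto
    moreover have "(SUP n. c * indicator (A n) x) \<le> c"
      by (intro SUP_least) (auto split: split_indicator)
    ultimately show ?thesis using True by simp
  next
    case False
    then have "x \<notin> A n" for n using AB by auto
    then show ?thesis using False by simp
  qed
  have inc: "incseq (\<lambda>n. {g 0..g (real n)})" "incseq (\<lambda>n::nat. {0..real n})"
    by (auto simp: incseq_def intro: order_trans[OF _ mono])
  have un: "(\<Union>n. {g 0..g (real n)}) = {g 0..}" "(\<Union>n::nat. {0..real n}) = {0..}"
  proof -
    have "\<exists>n. y \<le> g (real n)" for y
      using eventually_happens[OF filterlim_compose[OF lim filterlim_real_sequentially,
            unfolded filterlim_at_top, rule_format, of y]] by auto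
    then show "(\<Union>n. {g 0..g (real n)}) = {g 0..}" by auto
    show "(\<Union>n::nat. {0..real n}) = {0..}" by (auto simp: real_arch_simple)
  qed
  have "(\<integral>\<^sup>+x\<in>{g 0..}. f x \<partial>lborel) = (\<integral>\<^sup>+x. (SUP n. f x * indicator {g 0..g (real n)} x) \<partial>lborel)"
    by (simp add: SUP_ind[OF un(1)])
  also have "\<dots> = (SUP n. \<integral>\<^sup>+x. f x * indicator {g 0..g (real n)} x \<partial>lborel)"
  proof (intro nn_integral_monotone_convergence_SUP)
    show "incseq (\<lambda>n x. f x * indicator {g 0..g (real n)} x)"
      by (intro incseq_SucI le_funI mult_left_mono)
        (use inc(1) in \<open>auto dest!: incseq_SucD split: split_indicator\<close>)
  qed auto
  also have "\<dots> = (SUP n. \<integral>\<^sup>+x. f (g x) * ennreal (g' x) * indicator {0..real n} x \<partial>lborel)"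
  proof (intro SUP_cong refl)
    fix n :: nat
    show "(\<integral>\<^sup>+x. f x * indicator {g 0..g (real n)} x \<partial>lborel)
        = (\<integral>\<^sup>+x. f (g x) * ennreal (g' x) * indicator {0..real n} x \<partial>lborel)"
    \<comment> \<open>The rule for compact intervals wants nondegenerate ones. For
      \<open>n = 0\<close> both sides integrate over a single point and vanish.\<close>
    proof (cases "n = 0")
      case True
      then show ?thesis
        by (simp add: nn_integral_null_set[of "{g 0}"] nn_integral_null_set[of "{0}"] null_sets_def)
    next
      case False
      then show ?thesis
        by (intro nn_integral_substitution_aux) (auto intro: deriv nonneg continuous_on_subset[OF cont])
    qed
  qed
  also have "\<dots> = (\<integral>\<^sup>+x. (SUP n. f (g x) * ennreal (g' x) * indicator {0..real n} x) \<partial>lborel)"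
  proof (intro nn_integral_monotone_convergence_SUP[symmetric])
    show "incseq (\<lambda>n x. f (g x) * ennreal (g' x) * indicator {0..real n} x)"
      by (intro incseq_SucI le_funI mult_left_mono)
        (use inc(2) in \<open>auto dest!: incseq_SucD split: split_indicator\<close>)
  qed (use meas in auto)
  also have "\<dots> = (\<integral>\<^sup>+x\<in>{0..}. f (g x) * ennreal (g' x) \<partial>lborel)"
    by (simp add: SUP_ind[OF un(2)])
  finally show ?thesis .
qed

text \<open>The disc of radius \<open>sqrt t\<close> has area \<open>pi * t\<close>, so the two
  measures agree on all half-lines \<open>{..t}\<close>. These are stable under intersection and
  generate the Borel sets.\<close>

lemma distr_sum_squares_lborel:
  "distr lborel borel (\<lambda>p::real \<times> real. (fst p)\<^sup>2 + (snd p)\<^sup>2)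
     = density lborel (\<lambda>r. ennreal pi * indicator {0..} r)" (is "?L = ?R")
proof -
  have [measurable]: "(\<lambda>p::real \<times> real. (fst p)\<^sup>2 + (snd p)\<^sup>2) \<in> borel_measurable borel"
    by (intro borel_measurable_continuous_onI continuous_intros)
  \<comment> \<open>For negative \<open>t\<close> the value \<open>ennreal t\<close> is 0, so one
    formula also covers the empty preimage.\<close>
  have L: "emeasure ?L {..t} = ennreal pi * ennreal t" for t
  proof (cases "t \<ge> 0")
    case True
    have "emeasure ?L {..t} = emeasure lborel (cball (0::real \<times> real) (sqrt t))"
      using True
      by (subst emeasure_distr)
         (auto intro!: arg_cong[where f = "emeasure lborel"] simp: norm_prod_def)
    also have "\<dots> = ennreal (pi * t)"
      using True by (simp add: emeasure_cball unit_ball_vol_2)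
    finally show ?thesis using True by (simp add: ennreal_mult)
  next
    case False
    then have "(\<lambda>p::real \<times> real. (fst p)\<^sup>2 + (snd p)\<^sup>2) -` {..t} = {}"
      using sum_power2_ge_zero[THEN order_trans, where z = t] by auto
    then show ?thesis
      using False by (simp add: emeasure_distr ennreal_neg)
  qed
  have R: "emeasure ?R {..t} = ennreal pi * ennreal t" for t
  proof -
    have "emeasure ?R {..t} = (\<integral>\<^sup>+ r. ennreal pi * indicator {0..t} r \<partial>lborel)"
      by (subst emeasure_density) (auto intro!: nn_integral_cong split: split_indicator)
    also have "\<dots> = ennreal pi * emeasure lborel {0..t}"
      by (subst nn_integral_cmult_indicator) auto
    finally show ?thesis by (cases "t \<ge> 0") (auto simp: ennreal_neg)
  qed
  show ?thesis
  proof (rule measure_eqI_generator_eq[where E = "range atMost" and \<Omega> = UNIV and A = "\<lambda>n. {..real n}"])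
    show "Int_stable (range (atMost :: real \<Rightarrow> _))"
      by (auto simp: Int_stable_def)
    show "sets ?L = sigma_sets UNIV (range atMost)" "sets ?R = sigma_sets UNIV (range atMost)"
      by (auto simp: borel_eq_atMost)
    show "(\<Union>i. {..real i}) = UNIV" by (auto simp: real_arch_simple)
    show "emeasure ?L {..real i} \<noteq> \<infinity>" for i
      by (simp add: L ennreal_mult[symmetric])
  qed (auto simp: L R)
qed

lemma borel_measurable_vector3:
  "(\<lambda>(x::real, y::real, z::real). vector [x, y, z] :: real^3) \<in> borel_measurable borel"
proof -
  have "continuous_on UNIV (\<lambda>p::real \<times> real \<times> real. (\<chi> i. if i = 1 then fst p
      else if i = 2 then fst (snd p) else snd (snd p)) :: real^3)"
  proof (rule continuous_on_vec_lambda)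
    fix i :: 3
    show "continuous_on UNIV (\<lambda>p::real \<times> real \<times> real. if i = 1 then fst p
      else if i = 2 then fst (snd p) else snd (snd p))"
      by (cases "i = 1"; cases "i = 2") (auto intro!: continuous_intros)
  qed
  also have "(\<lambda>p. \<chi> i. if i = 1 then fst p else if i = 2 then fst (snd p) else snd (snd p))
      = (\<lambda>(x, y, z). vector [x, y, z] :: real^3)"
    by (auto simp: fun_eq_iff vec_eq_iff forall_3)
  finally show ?thesis
    by (rule borel_measurable_continuous_onI)
qed

text \<open>Lebesgue measure is determined by its values on boxes, and the preimage of a box is a
  product of three intervals. This lets Fubini's theorem separate one axis of \<open>real^3\<close>
  from the plane orthogonal to it.\<close>

lemma distr_vector3_lborel:
  "distr lborel borel (\<lambda>(x::real, y::real, z::real). vector [x, y, z] :: real^3) = lborel"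
proof (rule lborel_eqI[symmetric])
  let ?V = "\<lambda>(x::real, y::real, z::real). vector [x, y, z] :: real^3"
  fix l u :: "real^3" assume le: "\<And>b. b \<in> Basis \<Longrightarrow> l \<bullet> b \<le> u \<bullet> b"
  have lu: "l $ i \<le> u $ i" for i
    using le[of "axis i 1"] by (auto simp: inner_axis axis_in_Basis_iff)
  note borel_measurable_vector3[measurable]
  have box: "box (a, b, c) (a', b', c') = {a <..< a'} \<times> {b <..< b'} \<times> {c <..< c'}"
    for a b c a' b' c' :: real
    by (auto simp: box_def Basis_prod_def)
  have "?V -` box l u = box (l $ 1, l $ 2, l $ 3) (u $ 1, u $ 2, u $ 3)"
    by (auto simp: mem_box_cart forall_3 box)
  then have "emeasure (distr lborel borel ?V) (box l u)
      = emeasure lborel (box (l $ 1, l $ 2, l $ 3) (u $ 1, u $ 2, u $ 3))"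
    by (simp add: emeasure_distr)
  also have "\<dots> = emeasure (lborel \<Otimes>\<^sub>M lborel)
      ({l $ 1 <..< u $ 1} \<times> ({l $ 2 <..< u $ 2} \<times> {l $ 3 <..< u $ 3}))"
    by (simp add: lborel_prod box)
  also have "\<dots> = ennreal ((u $ 1 - l $ 1) * ((u $ 2 - l $ 2) * (u $ 3 - l $ 3)))"
    using lu by (subst lborel.emeasure_pair_measure_Times)
      (auto simp: lborel.emeasure_pair_measure_Times ennreal_mult simp flip: lborel_prod)
  also have "\<dots> = (\<Prod>b\<in>Basis. (u - l) \<bullet> b)"
  proof -
    have B: "(Basis :: (real^3) set) = (\<lambda>i. axis i 1) ` UNIV"
      by (auto simp: Basis_vec_def)
    have "inj (\<lambda>i. axis i 1 :: real^3)"
      by (simp add: inj_on_def axis_eq_axis)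
    then have "(\<Prod>b\<in>Basis. (u - l) \<bullet> b) = (\<Prod>i\<in>UNIV. (u - l) $ i)"
      unfolding B by (simp only: prod.reindex o_def inner_axis inner_real_def mult_1_right)
    also have "\<dots> = (u - l) $ 1 * ((u - l) $ 2 * (u - l) $ 3)"
      unfolding UNIV_3 by simp
    finally show ?thesis by (simp only: vector_minus_component)
  qed
  finally show "emeasure (distr lborel borel ?V) (box l u) = ennreal (\<Prod>b\<in>Basis. (u - l) \<bullet> b)" .
qed simp

text \<open>The preimage of a box under \<open>f\<close> is its image under the inverse of
  \<open>f\<close>, which is again orthogonal, and orthogonal images preserve Lebesgue
  measure.\<close>

lemma distr_orthogonal_lborel:
  fixes f :: "real^'n::{finite,wellorder} \<Rightarrow> real^'n::_"
  assumes f: "orthogonal_transformation f"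
  shows "distr lborel borel f = lborel"
proof (rule lborel_eqI[symmetric])
  fix l u :: "real^'n::_" assume le: "\<And>b. b \<in> Basis \<Longrightarrow> l \<bullet> b \<le> u \<bullet> b"
  define g where "g = inv f"
  have "bij f" using f by (rule orthogonal_transformation_bij)
  then have g: "orthogonal_transformation g" "f (g x) = x" "g (f x) = x" for x
    using f by (auto simp: g_def orthogonal_transformation_inv bij_is_surj surj_f_inv_f bij_is_inj)
  have [measurable]: "f \<in> borel_measurable borel"
    using f by (intro borel_measurable_continuous_onI linear_continuous_on)
      (simp add: orthogonal_transformation_def linear_conv_bounded_linear)
  have eq: "f -` box l u = g ` box l u"
  proof (intro equalityI subsetI)
    fix x assume "x \<in> f -` box l u"
    then show "x \<in> g ` box l u" using g(3)[of x] by (intro image_eqI[of _ _ "f x"]) auto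
  qed (use g(2) in auto)
  have [measurable]: "f -` box l u \<in> sets borel"
    using measurable_sets[of f borel borel "box l u"] by simp
  have *: "g ` box l u \<in> lmeasurable" "measure lebesgue (g ` box l u) = measure lebesgue (box l u)"
    using measurable_orthogonal_image[OF g(1), of "box l u"] measure_orthogonal_image[OF g(1), of "box l u"]
    by auto
  have "emeasure (distr lborel borel f) (box l u) = emeasure lebesgue (g ` box l u)"
    using eq[symmetric] by (simp add: emeasure_distr)
  also have "\<dots> = ennreal (measure lebesgue (box l u))"
    using * by (simp add: emeasure_eq_measure2)
  also have "\<dots> = emeasure lborel (box l u)"
    using emeasure_eq_measure2[OF lmeasurable_box[of l u]] by simp
  also have "\<dots> = (\<Prod>b\<in>Basis. (u - l) \<bullet> b)"
    using le by simp
  finally show "emeasure (distr lborel borel f) (box l u) = ennreal (\<Prod>b\<in>Basis. (u - l) \<bullet> b)" .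
qed simp

text \<open>Fubini's theorem splits off the first axis, and the planar Lebesgue measure is pushed
  forward along the squared radius. Taking the squared distance as the coordinate makes the Jacobian
  the constant \<open>pi\<close>.\<close>

lemma nn_integral_cylindrical:
  fixes G :: "real \<Rightarrow> real \<Rightarrow> ennreal"
  assumes [measurable]: "case_prod G \<in> borel_measurable (borel \<Otimes>\<^sub>M borel)"
  shows "(\<integral>\<^sup>+v. G (v $ 1) ((v $ 2)\<^sup>2 + (v $ 3)\<^sup>2) \<partial>(lborel :: (real^3) measure))
    = (\<integral>\<^sup>+x. (\<integral>\<^sup>+r\<in>{0..}. ennreal pi * G x r \<partial>lborel) \<partial>lborel)"
proof -
  let ?V = "\<lambda>(x::real, y::real, z::real). vector [x, y, z] :: real^3"
  let ?q = "\<lambda>p::real \<times> real. (fst p)\<^sup>2 + (snd p)\<^sup>2"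
  have V: "?V \<in> borel_measurable borel"
    by (rule borel_measurable_vector3)
  have q[measurable]: "?q \<in> borel_measurable borel"
    by (intro borel_measurable_continuous_onI continuous_intros)
  have comp[measurable]: "(\<lambda>v::real^3. v $ i) \<in> borel_measurable borel" for i
    by (intro borel_measurable_continuous_onI continuous_intros)
  have G[measurable]: "G x \<in> borel_measurable borel" for x
    using assms by measurable
  have m3: "(\<lambda>v::real^3. G (v $ 1) ((v $ 2)\<^sup>2 + (v $ 3)\<^sup>2)) \<in> borel_measurable borel"
    by measurable
  have "(\<integral>\<^sup>+v. G (v $ 1) ((v $ 2)\<^sup>2 + (v $ 3)\<^sup>2) \<partial>(lborel :: (real^3) measure))
      = (\<integral>\<^sup>+v. G (v $ 1) ((v $ 2)\<^sup>2 + (v $ 3)\<^sup>2) \<partial>distr lborel borel ?V)"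
    by (simp add: distr_vector3_lborel)
  also have "\<dots> = (\<integral>\<^sup>+p. G (fst p) (?q (snd p)) \<partial>(lborel :: (real \<times> real \<times> real) measure))"
    using V m3 by (subst nn_integral_distr) (auto simp: case_prod_beta)
  also have "\<dots> = (\<integral>\<^sup>+p. G (fst p) (?q (snd p)) \<partial>(lborel \<Otimes>\<^sub>M lborel))"
    by (simp add: lborel_prod)
  also have "\<dots> = (\<integral>\<^sup>+x. (\<integral>\<^sup>+p. G x (?q p) \<partial>lborel) \<partial>lborel)"
    by (subst lborel.nn_integral_fst[symmetric]) auto
  also have "\<dots> = (\<integral>\<^sup>+x. (\<integral>\<^sup>+r. G x r \<partial>distr lborel borel ?q) \<partial>lborel)"
    by (intro nn_integral_cong) (subst nn_integral_distr, auto)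
  also have "\<dots> = (\<integral>\<^sup>+x. (\<integral>\<^sup>+r\<in>{0..}. ennreal pi * G x r \<partial>lborel) \<partial>lborel)"
    unfolding distr_sum_squares_lborel
    by (intro nn_integral_cong) (subst nn_integral_density, auto intro!: nn_integral_cong simp: mult_ac)
  finally show ?thesis .
qed

section \<open>Kinematics of a pair of equal masses\<close>

text \<open>The Cauchy-Schwarz inequality for \<open>(sqrt c, x)\<close> and
  \<open>(sqrt c, y)\<close>, which amounts to \<open>c * (x - y)^2\<close> being nonnegative. It
  says that two particles of mass \<open>sqrt c\<close> moving on a line have invariant mass at
  least \<open>2 * sqrt c\<close>, and is the source of the threshold \<open>2 * m\<close>.\<close>

lemma four_mult_le_sum_sqrt_sq:
  fixes c x y :: real
  assumes "0 \<le> c"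
  shows "4 * c \<le> (sqrt (c + x\<^sup>2) + sqrt (c + y\<^sup>2))\<^sup>2 - (x + y)\<^sup>2"
proof -
  have "0 \<le> c * (x - y)\<^sup>2" using assms by simp
  then have "(c + x * y)\<^sup>2 \<le> (c + x\<^sup>2) * (c + y\<^sup>2)"
    by (simp add: power2_eq_square algebra_simps)
  then have "c + x * y \<le> sqrt ((c + x\<^sup>2) * (c + y\<^sup>2))"
    by (rule real_le_rsqrt)
  then show ?thesis
    using assms by (simp add: power2_sum real_sqrt_mult)
qed

text \<open>This determines the longitudinal momenta \<open>x\<close> that admit invariant mass
  \<open>s\<close>. After the square root is isolated and squared away, the terms in
  \<open>P^2\<close> cancel; the condition left is linear in \<open>P\<close>, hence quadratic in
  \<open>x\<close>, and completing the square gives an interval around \<open>k / 2\<close>.\<close>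

lemma sum_sqrt_sq_le_iff:
  fixes m k s x :: real
  assumes "m > 0" "2 * m \<le> s"
  shows "(sqrt (m\<^sup>2 + x\<^sup>2) + sqrt (m\<^sup>2 + (k - x)\<^sup>2))\<^sup>2 \<le> s\<^sup>2 + k\<^sup>2 \<longleftrightarrow>
    (x - k / 2)\<^sup>2 \<le> (s\<^sup>2 + k\<^sup>2) * (1 - 4 * m\<^sup>2 / s\<^sup>2) / 4"
proof -
  \<comment> \<open>The sum and the product of the two radicands depend on \<open>x\<close> only
    through \<open>P\<close>.\<close>
  define P where "P = x * (k - x)"
  define R where "R = s\<^sup>2 - 2 * m\<^sup>2 + 2 * P"
  let ?A = "m\<^sup>2 + x\<^sup>2" and ?B = "m\<^sup>2 + (k - x)\<^sup>2"
  have s: "s > 0" and sm: "4 * m\<^sup>2 \<le> s\<^sup>2"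
    using assms power_mono[of "2 * m" s 2] by (auto simp: power_mult_distrib)
  have AB: "?A * ?B = m^4 + m\<^sup>2 * (k\<^sup>2 - 2 * P) + P\<^sup>2"
    unfolding P_def by algebra
  have "(sqrt ?A + sqrt ?B)\<^sup>2 = ?A + ?B + 2 * sqrt (?A * ?B)"
    by (simp add: power2_sum real_sqrt_mult)
  also have "?A + ?B = 2 * m\<^sup>2 + k\<^sup>2 - 2 * P"
    unfolding P_def by algebra
  finally have "(sqrt ?A + sqrt ?B)\<^sup>2 \<le> s\<^sup>2 + k\<^sup>2 \<longleftrightarrow> 2 * sqrt (?A * ?B) \<le> R"
    unfolding R_def by auto
  also have "\<dots> \<longleftrightarrow> sqrt (4 * (?A * ?B)) \<le> R"
    by (simp add: real_sqrt_mult)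
  also have "\<dots> \<longleftrightarrow> 0 \<le> R \<and> 4 * (?A * ?B) \<le> R\<^sup>2"
  proof -
    have "0 \<le> sqrt (4 * (?A * ?B))" by simp
    then have "sqrt (4 * (?A * ?B)) \<le> R \<Longrightarrow> 0 \<le> R" by linarith
    then show ?thesis by (auto intro: sqrt_le_D real_le_lsqrt)
  qed
  also have "4 * (?A * ?B) \<le> R\<^sup>2 \<longleftrightarrow> 4 * m\<^sup>2 * k\<^sup>2 \<le> s^4 - 4 * m\<^sup>2 * s\<^sup>2 + 4 * P * s\<^sup>2"
    unfolding AB R_def by (simp add: power2_eq_square power4_eq_xxxx algebra_simps)
  \<comment> \<open>The polynomial inequality already contains the sign condition: it forces
    \<open>s^2 - 4 * m^2 + 4 * P\<close> to be nonnegative, and adding \<open>s^2\<close> to this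
    yields \<open>2 * R\<close>.\<close>
  also have "0 \<le> R \<and> 4 * m\<^sup>2 * k\<^sup>2 \<le> s^4 - 4 * m\<^sup>2 * s\<^sup>2 + 4 * P * s\<^sup>2 \<longleftrightarrow>
      4 * m\<^sup>2 * k\<^sup>2 \<le> s^4 - 4 * m\<^sup>2 * s\<^sup>2 + 4 * P * s\<^sup>2"
  proof -
    have "0 \<le> R" if "4 * m\<^sup>2 * k\<^sup>2 \<le> s^4 - 4 * m\<^sup>2 * s\<^sup>2 + 4 * P * s\<^sup>2"
    proof -
      have "0 \<le> 4 * m\<^sup>2 * k\<^sup>2" by simp
      also note that
      also have "s^4 - 4 * m\<^sup>2 * s\<^sup>2 + 4 * P * s\<^sup>2 = s\<^sup>2 * (s\<^sup>2 - 4 * m\<^sup>2 + 4 * P)"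
        by algebra
      finally have "0 \<le> s\<^sup>2 - 4 * m\<^sup>2 + 4 * P"
        using s by (simp add: zero_le_mult_iff)
      then show ?thesis unfolding R_def using zero_le_power2[of s] by linarith
    qed
    then show ?thesis by blast
  qed
  also have "\<dots> \<longleftrightarrow> (x - k / 2)\<^sup>2 * (4 * s\<^sup>2) \<le> (s\<^sup>2 + k\<^sup>2) * (s\<^sup>2 - 4 * m\<^sup>2)"
  proof -
    \<comment> \<open>Here \<open>P = k^2 / 4 - (x - k / 2)^2\<close>.\<close>
    have "(s\<^sup>2 + k\<^sup>2) * (s\<^sup>2 - 4 * m\<^sup>2) - (x - k / 2)\<^sup>2 * (4 * s\<^sup>2)
        = s^4 - 4 * m\<^sup>2 * s\<^sup>2 + 4 * P * s\<^sup>2 - 4 * m\<^sup>2 * k\<^sup>2"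
      unfolding P_def by (simp add: power2_eq_square power4_eq_xxxx field_simps)
    then show ?thesis by linarith
  qed
  also have "\<dots> \<longleftrightarrow> (x - k / 2)\<^sup>2 \<le> (s\<^sup>2 + k\<^sup>2) * (1 - 4 * m\<^sup>2 / s\<^sup>2) / 4"
  proof -
    have "(s\<^sup>2 + k\<^sup>2) * (1 - 4 * m\<^sup>2 / s\<^sup>2) / 4 = (s\<^sup>2 + k\<^sup>2) * (s\<^sup>2 - 4 * m\<^sup>2) / (4 * s\<^sup>2)"
      using s by (simp add: divide_simps)
    then show ?thesis using s by (simp add: pos_le_divide_eq mult_ac)
  qed
  finally show ?thesis .
qed

text \<open>The substitution is \<open>s = g r\<close>, so that
  \<open>s^2 + k^2 = (a r + b r)^2\<close>. Differentiating gives \<open>2 * s ds = (a + b) * (1 / a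
  + 1 / b) dr = (a + b)^2 / (a * b) dr\<close>, and dividing by \<open>s^2 + k^2\<close> leaves
  \<open>dr / (a * b)\<close>.\<close>

lemma nn_integral_pair_mass_substitution:
  fixes m k x :: real and h :: "real \<Rightarrow> ennreal"
  assumes m: "m > 0" and [measurable]: "h \<in> borel_measurable borel"
  defines "a \<equiv> \<lambda>r. sqrt (m\<^sup>2 + r + x\<^sup>2)" and "b \<equiv> \<lambda>r. sqrt (m\<^sup>2 + r + (k - x)\<^sup>2)"
  shows "(\<integral>\<^sup>+r\<in>{0..}. ennreal (1 / (a r * b r)) * h (a r + b r) \<partial>lborel)
    = (\<integral>\<^sup>+s\<in>{sqrt ((a 0 + b 0)\<^sup>2 - k\<^sup>2)..}. ennreal (2 * s / (s\<^sup>2 + k\<^sup>2)) * h (sqrt (s\<^sup>2 + k\<^sup>2)) \<partial>lborel)"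
proof -
  define g where "g r = sqrt ((a r + b r)\<^sup>2 - k\<^sup>2)" for r
  define g' where "g' r = (a r + b r)\<^sup>2 / (2 * g r * a r * b r)" for r
  \<comment> \<open>This bound serves twice: it keeps the radicand of \<open>g\<close> positive, so
    that \<open>g\<close> is differentiable, and it forces \<open>g\<close> to tend to
    infinity.\<close>
  have ge: "4 * (m\<^sup>2 + r) \<le> (a r + b r)\<^sup>2 - k\<^sup>2" if "0 \<le> r" for r
    using four_mult_le_sum_sqrt_sq[of "m\<^sup>2 + r" x "k - x"] that by (simp add: a_def b_def)
  have pos: "0 < m\<^sup>2 + r + z\<^sup>2" if "0 \<le> r" for r z
    using m that by (intro add_pos_nonneg) auto
  then have ab: "0 < a r" "0 < b r" if "0 \<le> r" for r
    using that by (auto simp: a_def b_def)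
  have gpos: "0 < (a r + b r)\<^sup>2 - k\<^sup>2" if "0 \<le> r" for r
    using ge[OF that] m that by (intro less_le_trans[OF _ ge]) (auto intro: add_pos_nonneg)
  then have g: "0 < g r" "(g r)\<^sup>2 = (a r + b r)\<^sup>2 - k\<^sup>2" if "0 \<le> r" for r
    using that by (auto simp: g_def less_imp_le)
  have deriv: "(g has_real_derivative g' r) (at r)" if "0 \<le> r" for r
  proof -
    have "((\<lambda>r. (a r + b r)\<^sup>2 - k\<^sup>2) has_real_derivative
        2 * (a r + b r) * (1 / (2 * a r) + 1 / (2 * b r))) (at r)"
      unfolding a_def b_def using pos[OF that, of x] pos[OF that, of "k - x"]
      by (auto intro!: derivative_eq_intros simp: divide_simps)
    then have "(g has_real_derivative
        inverse (g r) / 2 * (2 * (a r + b r) * (1 / (2 * a r) + 1 / (2 * b r)))) (at r)"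
      unfolding g_def using gpos[OF that] by (intro DERIV_chain2[OF DERIV_real_sqrt])
    also have "inverse (g r) / 2 * (2 * (a r + b r) * (1 / (2 * a r) + 1 / (2 * b r))) = g' r"
      using ab[OF that] g(1)[OF that] by (simp add: g'_def field_simps power2_eq_square)
    finally show ?thesis .
  qed
  have "continuous_on {0..} a" "continuous_on {0..} b"
    unfolding a_def b_def by (intro continuous_intros)+
  moreover from this have "continuous_on {0..} g"
    unfolding g_def by (intro continuous_intros)
  ultimately have cont: "continuous_on {0..} g'"
    unfolding g'_def using ab g(1) by (intro continuous_intros) (auto simp: less_imp_neq[symmetric])
  have lim: "filterlim g at_top at_top"
  proof (rule filterlim_at_top_mono[OF sqrt_at_top])
    show "eventually (\<lambda>r. sqrt r \<le> g r) at_top"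
      using eventually_ge_at_top[of 0]
    proof eventually_elim
      case (elim r)
      then have "r \<le> 4 * (m\<^sup>2 + r)"
        using zero_le_power2[of m] by (simp add: algebra_simps)
      then show ?case
        unfolding g_def using ge[OF elim] by (intro real_sqrt_le_mono) (rule order_trans)
    qed
  qed
  have "(\<integral>\<^sup>+s\<in>{g 0..}. ennreal (2 * s / (s\<^sup>2 + k\<^sup>2)) * h (sqrt (s\<^sup>2 + k\<^sup>2)) \<partial>lborel)
      = (\<integral>\<^sup>+r\<in>{0..}. ennreal (2 * g r / ((g r)\<^sup>2 + k\<^sup>2)) * h (sqrt ((g r)\<^sup>2 + k\<^sup>2)) * ennreal (g' r) \<partial>lborel)"
    using ab g(1) by (intro nn_integral_substitution_atLeast deriv cont lim)
      (auto simp: g'_def less_imp_le intro!: divide_nonneg_pos)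
  also have "\<dots> = (\<integral>\<^sup>+r\<in>{0..}. ennreal (1 / (a r * b r)) * h (a r + b r) \<partial>lborel)"
  proof (rule nn_integral_cong)
    fix r :: real
    show "ennreal (2 * g r / ((g r)\<^sup>2 + k\<^sup>2)) * h (sqrt ((g r)\<^sup>2 + k\<^sup>2)) * ennreal (g' r) * indicator {0..} r
        = ennreal (1 / (a r * b r)) * h (a r + b r) * indicator {0..} r"
    proof (cases "0 \<le> r")
      case True
      note pos = ab[OF True] g(1)[OF True]
      have e: "(g r)\<^sup>2 + k\<^sup>2 = (a r + b r)\<^sup>2" using g(2)[OF True] by simp
      have "ennreal (2 * g r / (a r + b r)\<^sup>2) * ennreal (g' r) = ennreal (2 * g r / (a r + b r)\<^sup>2 * g' r)"
        using pos by (intro ennreal_mult[symmetric]) (auto simp: g'_def less_imp_le)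
      also have "2 * g r / (a r + b r)\<^sup>2 * g' r = 1 / (a r * b r)"
        using pos by (simp add: g'_def)
      finally have "ennreal (2 * g r / (a r + b r)\<^sup>2) * ennreal (g' r) * h (a r + b r)
          = ennreal (1 / (a r * b r)) * h (a r + b r)" by simp
      then show ?thesis
        using pos True by (simp add: e mult.assoc mult.commute[of "h _"])
    qed simp
  qed
  finally show ?thesis by (simp add: g_def)
qed

lemma borel_measurable_sigma_spec [measurable]: "sigma_spec m \<in> borel_measurable borel"
  unfolding sigma_spec_def Z_def by measurable

lemma sigma_spec_nonneg: "0 < m \<Longrightarrow> 0 \<le> sigma_spec m s"
proof -
  assume "0 < m"
  moreover have "0 \<le> s\<^sup>2 / (4 * m\<^sup>2) - 1" if "2 * m \<le> s"
    using power_mono[OF that, of 2] \<open>0 < m\<close> by (simp add: power_mult_distrib)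
  ultimately show ?thesis by (simp add: sigma_spec_def Z_def)
qed

text \<open>Above the threshold the set is an interval of length
  \<open>2 * \<rho> = sqrt (s^2 + k^2) * sqrt (1 - 4 * m^2 / s^2)\<close>, while
  \<open>sigma_spec m s = 2 * pi * s * sqrt (1 - 4 * m^2 / s^2)\<close>. Below the threshold the set
  is empty and \<open>sigma_spec\<close> is 0.\<close>

lemma emeasure_pair_mass_le:
  fixes m k s :: real
  assumes "m > 0"
  shows "ennreal (2 * pi * s / (s\<^sup>2 + k\<^sup>2)) *
      emeasure lborel {x. sqrt ((sqrt (m\<^sup>2 + x\<^sup>2) + sqrt (m\<^sup>2 + (k - x)\<^sup>2))\<^sup>2 - k\<^sup>2) \<le> s}
    = ennreal (sigma_spec m s / sqrt (s\<^sup>2 + k\<^sup>2))"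
proof (cases "2 * m \<le> s")
  case True
  define \<rho> where "\<rho> = sqrt ((s\<^sup>2 + k\<^sup>2) * (1 - 4 * m\<^sup>2 / s\<^sup>2) / 4)"
  have s: "s > 0" and sm: "4 * m\<^sup>2 \<le> s\<^sup>2"
    using True assms power_mono[of "2 * m" s 2] by (auto simp: power_mult_distrib)
  have q: "0 \<le> (s\<^sup>2 + k\<^sup>2) * (1 - 4 * m\<^sup>2 / s\<^sup>2) / 4"
    using s sm by (auto simp: divide_simps)
  then have \<rho>: "0 \<le> \<rho>" "\<rho>\<^sup>2 = (s\<^sup>2 + k\<^sup>2) * (1 - 4 * m\<^sup>2 / s\<^sup>2) / 4"
    unfolding \<rho>_def by (rule real_sqrt_ge_zero, rule real_sqrt_pow2)
  have "{x. sqrt ((sqrt (m\<^sup>2 + x\<^sup>2) + sqrt (m\<^sup>2 + (k - x)\<^sup>2))\<^sup>2 - k\<^sup>2) \<le> s}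
      = {x. (sqrt (m\<^sup>2 + x\<^sup>2) + sqrt (m\<^sup>2 + (k - x)\<^sup>2))\<^sup>2 \<le> s\<^sup>2 + k\<^sup>2}"
  proof -
    \<comment> \<open>For \<open>y < k^2\<close> both sides hold, because \<open>sqrt\<close> takes
      negative values at negative arguments and \<open>s\<close> is positive.\<close>
    have "sqrt (y - k\<^sup>2) \<le> s \<longleftrightarrow> y \<le> s\<^sup>2 + k\<^sup>2" for y
      using s sqrt_le_D[of "y - k\<^sup>2" s] real_le_lsqrt[of s "y - k\<^sup>2"] by auto
    then show ?thesis by simp
  qed
  also have "\<dots> = {x. (x - k / 2)\<^sup>2 \<le> \<rho>\<^sup>2}"
    using sum_sqrt_sq_le_iff[OF assms True] by (simp add: \<rho>(2))
  also have "\<dots> = {k / 2 - \<rho>..k / 2 + \<rho>}"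
    using \<rho>(1) by (auto simp flip: abs_le_square_iff)
  finally have "emeasure lborel {x. sqrt ((sqrt (m\<^sup>2 + x\<^sup>2) + sqrt (m\<^sup>2 + (k - x)\<^sup>2))\<^sup>2 - k\<^sup>2) \<le> s}
      = ennreal (2 * \<rho>)"
    using \<rho>(1) by simp
  moreover have "2 * pi * s / (s\<^sup>2 + k\<^sup>2) * (2 * \<rho>) = sigma_spec m s / sqrt (s\<^sup>2 + k\<^sup>2)"
  proof -
    have "s\<^sup>2 / (4 * m\<^sup>2) - 1 = s\<^sup>2 * (1 - 4 * m\<^sup>2 / s\<^sup>2) / (4 * m\<^sup>2)"
      using s assms by (simp add: field_simps)
    then have "Z m s = s * sqrt (1 - 4 * m\<^sup>2 / s\<^sup>2) / (2 * m)"
      using s assms by (simp add: Z_def real_sqrt_mult real_sqrt_divide)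
    then have sig: "sigma_spec m s = 2 * pi * s * sqrt (1 - 4 * m\<^sup>2 / s\<^sup>2)"
      using True assms by (simp add: sigma_spec_def)
    have "2 * \<rho> = sqrt (s\<^sup>2 + k\<^sup>2) * sqrt (1 - 4 * m\<^sup>2 / s\<^sup>2)"
      unfolding \<rho>_def by (simp add: real_sqrt_mult real_sqrt_divide)
    moreover have "sqrt (s\<^sup>2 + k\<^sup>2) * sqrt (s\<^sup>2 + k\<^sup>2) = s\<^sup>2 + k\<^sup>2"
      by simp
    moreover have "0 < sqrt (s\<^sup>2 + k\<^sup>2)"
      using s by (simp add: add_pos_nonneg)
    ultimately show ?thesis
      unfolding sig by (simp add: divide_simps del: real_sqrt_mult_self)
  qed
  ultimately show ?thesis
    using s \<rho>(1) by (simp add: ennreal_mult[symmetric])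
next
  case False
  have "\<not> sqrt ((sqrt (m\<^sup>2 + x\<^sup>2) + sqrt (m\<^sup>2 + (k - x)\<^sup>2))\<^sup>2 - k\<^sup>2) \<le> s" for x
  proof -
    have "2 * m \<le> sqrt ((sqrt (m\<^sup>2 + x\<^sup>2) + sqrt (m\<^sup>2 + (k - x)\<^sup>2))\<^sup>2 - k\<^sup>2)"
      using four_mult_le_sum_sqrt_sq[of "m\<^sup>2" x "k - x"]
      by (intro real_le_rsqrt) (simp add: power_mult_distrib)
    then show ?thesis using False by linarith
  qed
  then show ?thesis
    using False by (simp add: sigma_spec_def)
qed

section \<open>The momentum integral at fixed total momentum\<close>

text \<open>With the total momentum on the first axis, both energies depend only on
  \<open>v $ 1\<close> and the squared distance from that axis. Cylindrical coordinates and the mass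
  substitution turn the integral into one over \<open>x\<close> and \<open>s\<close>; integrating
  over \<open>x\<close> first measures \<open>{x. S x \<le> s}\<close>.\<close>

lemma nn_integral_pair_energy_axis:
  fixes m k :: real and h :: "real \<Rightarrow> ennreal"
  assumes m: "m > 0" and [measurable]: "h \<in> borel_measurable borel"
  shows "(\<integral>\<^sup>+v. ennreal (1 / (omega m v * omega m (k *\<^sub>R axis 1 1 - v)))
        * h (omega m v + omega m (k *\<^sub>R axis 1 1 - v)) \<partial>lborel)
    = (\<integral>\<^sup>+s. ennreal (sigma_spec m s / sqrt (s\<^sup>2 + k\<^sup>2)) * h (sqrt (s\<^sup>2 + k\<^sup>2)) \<partial>lborel)"
proof -
  define a where "a x r = sqrt (m\<^sup>2 + r + x\<^sup>2)" for x r
  \<comment> \<open>\<open>S x\<close> is the least invariant mass at longitudinal momentum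
    \<open>x\<close>, reached at \<open>r = 0\<close>; it is the lower limit after the
    substitution.\<close>
  define S where "S x = sqrt ((a x 0 + a (k - x) 0)\<^sup>2 - k\<^sup>2)" for x
  define F where "F s = ennreal (2 * pi * s / (s\<^sup>2 + k\<^sup>2)) * h (sqrt (s\<^sup>2 + k\<^sup>2))" for s
  have [measurable]: "case_prod a \<in> borel_measurable (borel \<Otimes>\<^sub>M borel)"
    unfolding a_def by measurable
  have [measurable]: "S \<in> borel_measurable borel" "F \<in> borel_measurable borel"
    unfolding S_def F_def a_def by measurable
  have om: "omega m v = a (v $ 1) ((v $ 2)\<^sup>2 + (v $ 3)\<^sup>2)"
    "omega m (k *\<^sub>R axis 1 1 - v) = a (k - v $ 1) ((v $ 2)\<^sup>2 + (v $ 3)\<^sup>2)" for v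
    by (simp_all add: omega_def a_def norm_real3_sq axis_def algebra_simps)
  have pos: "2 * m \<le> S x" for x
    using four_mult_le_sum_sqrt_sq[of "m\<^sup>2" x "k - x"]
    unfolding S_def a_def by (intro real_le_rsqrt) (simp add: power_mult_distrib)
  have "(\<integral>\<^sup>+v. ennreal (1 / (omega m v * omega m (k *\<^sub>R axis 1 1 - v)))
        * h (omega m v + omega m (k *\<^sub>R axis 1 1 - v)) \<partial>lborel)
      = (\<integral>\<^sup>+x. (\<integral>\<^sup>+r\<in>{0..}. ennreal pi *
          (ennreal (1 / (a x r * a (k - x) r)) * h (a x r + a (k - x) r)) \<partial>lborel) \<partial>lborel)"
    \<comment> \<open>The order matters: the first equation would also match the energy of the
      second particle.\<close>
    unfolding om(2) unfolding om(1)
    by (rule nn_integral_cylindrical[where G = "\<lambda>x r. ennreal (1 / (a x r * a (k - x) r)) * h (a x r + a (k - x) r)"])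
      measurable
  also have "\<dots> = (\<integral>\<^sup>+x. (\<integral>\<^sup>+s. F s * indicator {S x..} s \<partial>lborel) \<partial>lborel)"
  proof (rule nn_integral_cong)
    fix x
    have "(\<integral>\<^sup>+r\<in>{0..}. ennreal pi * (ennreal (1 / (a x r * a (k - x) r)) * h (a x r + a (k - x) r)) \<partial>lborel)
        = ennreal pi * (\<integral>\<^sup>+r\<in>{0..}. ennreal (1 / (a x r * a (k - x) r)) * h (a x r + a (k - x) r) \<partial>lborel)"
      by (subst nn_integral_cmult[symmetric]) (auto simp: mult.assoc)
    also have "\<dots> = ennreal pi * (\<integral>\<^sup>+s\<in>{S x..}. ennreal (2 * s / (s\<^sup>2 + k\<^sup>2)) * h (sqrt (s\<^sup>2 + k\<^sup>2)) \<partial>lborel)"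
      unfolding a_def S_def by (subst nn_integral_pair_mass_substitution[OF m]) auto
    also have "\<dots> = (\<integral>\<^sup>+s. ennreal pi * (ennreal (2 * s / (s\<^sup>2 + k\<^sup>2)) * h (sqrt (s\<^sup>2 + k\<^sup>2)) * indicator {S x..} s) \<partial>lborel)"
      by (subst nn_integral_cmult) auto
    also have "\<dots> = (\<integral>\<^sup>+s. F s * indicator {S x..} s \<partial>lborel)"
    proof (rule nn_integral_cong)
      fix s :: real
      show "ennreal pi * (ennreal (2 * s / (s\<^sup>2 + k\<^sup>2)) * h (sqrt (s\<^sup>2 + k\<^sup>2)) * indicator {S x..} s)
          = F s * indicator {S x..} s"
      \<comment> \<open>On the support of the indicator \<open>s\<close> is positive, so the real
        factors can be multiplied inside \<open>ennreal\<close>.\<close>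
      proof (cases "S x \<le> s")
        case True
        then have "0 \<le> 2 * s / (s\<^sup>2 + k\<^sup>2)" using pos[of x] m by auto
        then have "ennreal pi * ennreal (2 * s / (s\<^sup>2 + k\<^sup>2)) = ennreal (2 * pi * s / (s\<^sup>2 + k\<^sup>2))"
          by (simp add: ennreal_mult[symmetric] mult_ac)
        then show ?thesis by (simp add: F_def mult.assoc[symmetric])
      qed simp
    qed
    finally show "(\<integral>\<^sup>+r\<in>{0..}. ennreal pi * (ennreal (1 / (a x r * a (k - x) r)) * h (a x r + a (k - x) r)) \<partial>lborel)
      = (\<integral>\<^sup>+s. F s * indicator {S x..} s \<partial>lborel)" .
  qed
  \<comment> \<open>The condition \<open>S x \<le> s\<close> is now read as a condition on
    \<open>x\<close>, ready for the exchange of integrals.\<close>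
  also have "\<dots> = (\<integral>\<^sup>+x. (\<integral>\<^sup>+s. F s * indicator {x. S x \<le> s} x \<partial>lborel) \<partial>lborel)"
    by (intro nn_integral_cong) (auto split: split_indicator)
  also have "\<dots> = (\<integral>\<^sup>+s. (\<integral>\<^sup>+x. F s * indicator {x. S x \<le> s} x \<partial>lborel) \<partial>lborel)"
    by (rule lborel_pair.Fubini') (simp add: indicator_def)
  also have "\<dots> = (\<integral>\<^sup>+s. ennreal (sigma_spec m s / sqrt (s\<^sup>2 + k\<^sup>2)) * h (sqrt (s\<^sup>2 + k\<^sup>2)) \<partial>lborel)"
  proof (rule nn_integral_cong)
    fix s :: real
    have "(\<integral>\<^sup>+x. F s * indicator {x. S x \<le> s} x \<partial>lborel)
        = ennreal (2 * pi * s / (s\<^sup>2 + k\<^sup>2)) * emeasure lborel {x. S x \<le> s} * h (sqrt (s\<^sup>2 + k\<^sup>2))"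
      by (subst nn_integral_cmult_indicator) (auto simp: F_def mult_ac)
    also have "ennreal (2 * pi * s / (s\<^sup>2 + k\<^sup>2)) * emeasure lborel {x. S x \<le> s}
        = ennreal (sigma_spec m s / sqrt (s\<^sup>2 + k\<^sup>2))"
      using emeasure_pair_mass_le[OF m, of s k] by (simp add: S_def a_def)
    finally show "(\<integral>\<^sup>+x. F s * indicator {x. S x \<le> s} x \<partial>lborel)
        = ennreal (sigma_spec m s / sqrt (s\<^sup>2 + k\<^sup>2)) * h (sqrt (s\<^sup>2 + k\<^sup>2))" .
  qed
  finally show ?thesis .
qed

text \<open>A rotation carrying \<open>norm u\<close> times the first unit vector to
  \<open>u\<close> preserves Lebesgue measure and both energies, which reduces the claim to the
  previous lemma with \<open>k = norm u\<close>.\<close>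

lemma nn_integral_pair_energy:
  fixes m :: real and h :: "real \<Rightarrow> ennreal" and u :: "real^3"
  assumes m: "m > 0" and [measurable]: "h \<in> borel_measurable borel"
  shows "(\<integral>\<^sup>+v. ennreal (1 / (omega m v * omega m (u - v))) * h (omega m v + omega m (u - v)) \<partial>lborel)
    = (\<integral>\<^sup>+s. ennreal (sigma_spec m s / omega s u) * h (omega s u) \<partial>lborel)"
proof -
  define e :: "real^3" where "e = norm u *\<^sub>R axis 1 1"
  have "norm e = norm u" by (simp add: e_def)
  then obtain f where f: "orthogonal_transformation f" "f e = u"
    using orthogonal_transformation_exists by blast
  have [measurable]: "f \<in> borel_measurable borel"
    using f(1) by (intro borel_measurable_continuous_onI linear_continuous_on)
      (simp add: orthogonal_transformation_def linear_conv_bounded_linear)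
  have om: "omega m (f v) = omega m v" "omega m (u - f v) = omega m (e - v)" for v
  proof -
    have "u - f v = f (e - v)"
      using f by (simp add: linear_diff orthogonal_transformation_linear)
    then show "omega m (u - f v) = omega m (e - v)" "omega m (f v) = omega m v"
      using f(1) by (simp_all add: omega_def orthogonal_transformation_norm)
  qed
  have "(\<integral>\<^sup>+v. ennreal (1 / (omega m v * omega m (u - v))) * h (omega m v + omega m (u - v)) \<partial>lborel)
      = (\<integral>\<^sup>+v. ennreal (1 / (omega m v * omega m (u - v))) * h (omega m v + omega m (u - v))
          \<partial>distr lborel borel f)"
    using f(1) by (simp add: distr_orthogonal_lborel)
  also have "\<dots> = (\<integral>\<^sup>+v. ennreal (1 / (omega m v * omega m (e - v)))
      * h (omega m v + omega m (e - v)) \<partial>lborel)"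
    by (subst nn_integral_distr) (auto simp: om)
  also have "\<dots> = (\<integral>\<^sup>+s. ennreal (sigma_spec m s / omega s u) * h (omega s u) \<partial>lborel)"
    unfolding e_def nn_integral_pair_energy_axis[OF assms] by (simp add: omega_def)
  finally show ?thesis .
qed

section \<open>The convolution as an integral over masses\<close>

lemma nn_integral_Omega:
  assumes "m > 0" and [measurable]: "F \<in> borel_measurable borel"
  shows "(\<integral>\<^sup>+p. F p \<partial>Omega m) = (\<integral>\<^sup>+v. ennreal (1 / omega m v) * F (lift_shell m v) \<partial>lborel)"
  by (simp add: Omega_eq_distr[OF assms(1)] nn_integral_distr nn_integral_density)

text \<open>Joint measurability in mass and momentum is what the exchange of the integrals over
  \<open>s\<close> and \<open>u\<close> requires.\<close>

lemma borel_measurable_lift_shell_pair [measurable]: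
  "(\<lambda>(s, v). lift_shell s v) \<in> borel_measurable (borel \<Otimes>\<^sub>M borel)"
proof -
  have "continuous_on UNIV (\<lambda>p. lift_shell (fst p) (snd p))"
    unfolding lift_shell_def omega_def
  proof (rule continuous_on_vec_lambda)
    fix i :: 4
    show "continuous_on UNIV (\<lambda>p::real \<times> (real^3). if i = 0 then sqrt ((fst p)\<^sup>2 + (norm (snd p))\<^sup>2)
        else if i = 1 then snd p $ 1 else if i = 2 then snd p $ 2 else snd p $ 3)"
      by (cases "i = 0"; cases "i = 1"; cases "i = 2") (auto intro!: continuous_intros)
  qed
  then show ?thesis
    by (simp add: borel_prod borel_measurable_continuous_onI case_prod_beta)
qed

lemma borel_measurable_omega_pair [measurable]:
  "(\<lambda>(s, v). omega s v) \<in> borel_measurable (borel \<Otimes>\<^sub>M borel)"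
  unfolding omega_def by measurable

lemma nn_integral_lborel_shift:
  fixes F :: "'a::euclidean_space \<Rightarrow> ennreal"
  assumes [measurable]: "F \<in> borel_measurable borel"
  shows "(\<integral>\<^sup>+w. F w \<partial>lborel) = (\<integral>\<^sup>+u. F (u - v) \<partial>lborel)"
proof -
  have "(\<integral>\<^sup>+w. F w \<partial>lborel) = (\<integral>\<^sup>+w. F w \<partial>distr lborel borel ((+) (- v)))"
    by (simp add: lborel_distr_plus)
  then show ?thesis by (simp add: nn_integral_distr)
qed

text \<open>Separating energy from momentum makes the indicator of \<open>\<Gamma>\<close>, at fixed
  total momentum, a function of the total energy alone, which is the form of \<open>h\<close> in
  \<open>nn_integral_pair_energy\<close>.\<close>

definition point4 :: "real \<Rightarrow> real^3 \<Rightarrow> real^4" where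
  "point4 t v = (\<chi> i. if i = 0 then t else if i = 1 then v $ 1 else if i = 2 then v $ 2 else v $ 3)"

lemma borel_measurable_point4 [measurable]: "(\<lambda>t. point4 t v) \<in> borel_measurable borel"
proof -
  have "continuous_on UNIV (\<lambda>t. point4 t v)"
    unfolding point4_def
  proof (rule continuous_on_vec_lambda)
    fix i :: 4
    show "continuous_on UNIV (\<lambda>t. if i = 0 then t else if i = 1 then v $ 1 else if i = 2 then v $ 2 else v $ 3)"
      by (cases "i = 0") (auto intro!: continuous_intros)
  qed
  then show ?thesis by (rule borel_measurable_continuous_onI)
qed

lemma point4_omega: "point4 (omega s u) u = lift_shell s u"
  by (simp add: point4_def lift_shell_def)

lemma lift_shell_add: "lift_shell m v + lift_shell m w = point4 (omega m v + omega m w) (v + w)"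
  by (simp add: point4_def lift_shell_def vec_eq_iff)

lemma emeasure_convolution_Omega_momenta:
  assumes m: "m > 0" and \<Gamma>[measurable]: "\<Gamma> \<in> sets borel"
  shows "emeasure (Omega m \<star> Omega m) \<Gamma>
    = (\<integral>\<^sup>+v. ennreal (1 / omega m v) *
        (\<integral>\<^sup>+w. ennreal (1 / omega m w) * indicator \<Gamma> (lift_shell m v + lift_shell m w) \<partial>lborel) \<partial>lborel)"
proof -
  interpret sigma_finite_measure "Omega m" by (rule sigma_finite_Omega[OF m])
  have [measurable]: "(\<lambda>p. \<integral>\<^sup>+q. indicator \<Gamma> (p + q) \<partial>Omega m) \<in> borel_measurable borel"
    by measurable
  show ?thesis
    by (simp add: emeasure_convolution_Omega[OF m \<Gamma>] nn_integral_Omega[OF m])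
qed

text \<open>The double integral over two momenta is rewritten in terms of the total momentum
  \<open>u\<close> and one momentum \<open>v\<close>. At fixed \<open>u\<close> the integral over
  \<open>v\<close> becomes an integral over the mass \<open>s\<close>, and the remaining integral
  over \<open>u\<close> is that of \<open>Omega s\<close>.\<close>

lemma emeasure_convolution_Omega_spectrum:
  assumes m: "m > 0" and \<Gamma>[measurable]: "\<Gamma> \<in> sets borel"
  shows "emeasure (Omega m \<star> Omega m) \<Gamma>
    = (\<integral>\<^sup>+s. ennreal (sigma_spec m s) * emeasure (Omega s) \<Gamma> \<partial>lborel)"
proof -
  have "emeasure (Omega m \<star> Omega m) \<Gamma>
      = (\<integral>\<^sup>+v. ennreal (1 / omega m v) *
          (\<integral>\<^sup>+w. ennreal (1 / omega m w) * indicator \<Gamma> (lift_shell m v + lift_shell m w) \<partial>lborel) \<partial>lborel)"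
    by (rule emeasure_convolution_Omega_momenta[OF m \<Gamma>])
  \<comment> \<open>By translation invariance the second momentum is written as
    \<open>u - v\<close>.\<close>
  also have "\<dots> = (\<integral>\<^sup>+v. ennreal (1 / omega m v) *
          (\<integral>\<^sup>+u. ennreal (1 / omega m (u - v)) * indicator \<Gamma> (lift_shell m v + lift_shell m (u - v)) \<partial>lborel) \<partial>lborel)"
    by (intro nn_integral_cong arg_cong2[where f = "(*)"] refl nn_integral_lborel_shift) measurable
  also have "\<dots> = (\<integral>\<^sup>+v. (\<integral>\<^sup>+u. ennreal (1 / omega m v) *
          (ennreal (1 / omega m (u - v)) * indicator \<Gamma> (lift_shell m v + lift_shell m (u - v))) \<partial>lborel) \<partial>lborel)"
    by (intro nn_integral_cong nn_integral_cmult[symmetric]) measurable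
  also have "\<dots> = (\<integral>\<^sup>+v. (\<integral>\<^sup>+u. ennreal (1 / (omega m v * omega m (u - v))) *
          indicator \<Gamma> (lift_shell m v + lift_shell m (u - v)) \<partial>lborel) \<partial>lborel)"
    using m by (intro nn_integral_cong)
      (simp add: mult.assoc[symmetric] ennreal_mult[symmetric] omega_pos less_imp_le)
  also have "\<dots> = (\<integral>\<^sup>+u. (\<integral>\<^sup>+v. ennreal (1 / (omega m v * omega m (u - v))) *
          indicator \<Gamma> (lift_shell m v + lift_shell m (u - v)) \<partial>lborel) \<partial>lborel)"
    by (rule lborel_pair.Fubini') measurable
  \<comment> \<open>Here \<open>h\<close> is the indicator of the energies \<open>t\<close> with
    \<open>point4 t u\<close> in \<open>\<Gamma>\<close>.\<close>
  also have "\<dots> = (\<integral>\<^sup>+u. (\<integral>\<^sup>+s. ennreal (sigma_spec m s / omega s u) * indicator \<Gamma> (lift_shell s u) \<partial>lborel) \<partial>lborel)"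
    using nn_integral_pair_energy[OF m, of "\<lambda>t. indicator \<Gamma> (point4 t _)"]
    by (simp add: lift_shell_add point4_omega)
  also have "\<dots> = (\<integral>\<^sup>+s. (\<integral>\<^sup>+u. ennreal (sigma_spec m s / omega s u) * indicator \<Gamma> (lift_shell s u) \<partial>lborel) \<partial>lborel)"
    by (rule lborel_pair.Fubini') measurable
  also have "\<dots> = (\<integral>\<^sup>+s. ennreal (sigma_spec m s) * emeasure (Omega s) \<Gamma> \<partial>lborel)"
  proof (rule nn_integral_cong)
    fix s :: real
    show "(\<integral>\<^sup>+u. ennreal (sigma_spec m s / omega s u) * indicator \<Gamma> (lift_shell s u) \<partial>lborel)
        = ennreal (sigma_spec m s) * emeasure (Omega s) \<Gamma>"
    \<comment> \<open>The description of \<open>Omega s\<close> as a pushforward is available for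
      positive \<open>s\<close>; below \<open>2 * m\<close> the factor \<open>sigma_spec\<close>
      makes both sides 0.\<close>
    proof (cases "2 * m \<le> s")
      case True
      then have s: "s > 0" using m by simp
      have "emeasure (Omega s) \<Gamma> = (\<integral>\<^sup>+u. ennreal (1 / omega s u) * indicator \<Gamma> (lift_shell s u) \<partial>lborel)"
        using nn_integral_Omega[OF s, of "indicator \<Gamma>"] by simp
      then have "ennreal (sigma_spec m s) * emeasure (Omega s) \<Gamma>
          = (\<integral>\<^sup>+u. ennreal (sigma_spec m s) * (ennreal (1 / omega s u) * indicator \<Gamma> (lift_shell s u)) \<partial>lborel)"
        by (simp add: nn_integral_cmult)
      also have "\<dots> = (\<integral>\<^sup>+u. ennreal (sigma_spec m s / omega s u) * indicator \<Gamma> (lift_shell s u) \<partial>lborel)"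
        using sigma_spec_nonneg[OF m] omega_pos[OF s]
        by (intro nn_integral_cong) (simp add: mult.assoc[symmetric] ennreal_mult[symmetric] less_imp_le)
      finally show ?thesis by simp
    qed (simp add: sigma_spec_def)
  qed
  finally show ?thesis .
qed

section \<open>Finiteness on bounded sets and conclusion\<close>

text \<open>Energies are nonnegative and dominate momenta. If the sum of two points on the shell
  lies in a ball of radius \<open>B\<close>, both momenta have norm at most \<open>B\<close>, so the
  double integral is at most \<open>1 / m^2\<close> times the square of the volume of a
  ball.\<close>

lemma emeasure_convolution_Omega_bounded:
  assumes m: "m > 0" and \<Gamma>[measurable]: "\<Gamma> \<in> sets borel" and "bounded \<Gamma>"
  shows "emeasure (Omega m \<star> Omega m) \<Gamma> < \<infinity>"
proof -
  obtain B where B: "\<And>p. p \<in> \<Gamma> \<Longrightarrow> norm p \<le> B"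
    using assms(3) unfolding bounded_iff by blast
  have om: "norm v \<le> omega m v" "m \<le> omega m v" for v
    using m by (auto simp: omega_def intro!: real_le_rsqrt)
  have inner: "ennreal (1 / omega m v) * F \<le> ennreal (1 / m) * F" for v F
    using om(2)[of v] m by (intro mult_right_mono ennreal_leI) (auto simp: frac_le)
  have ind: "indicator \<Gamma> (lift_shell m v + lift_shell m w) \<le> (indicator (cball 0 B) v * indicator (cball 0 B) w :: ennreal)" for v w
  proof (cases "lift_shell m v + lift_shell m w \<in> \<Gamma>")
    case True
    \<comment> \<open>Component 0 is the total energy.\<close>
    have "omega m v + omega m w \<le> norm (lift_shell m v + lift_shell m w)"
      using component_le_norm_cart[of "lift_shell m v + lift_shell m w" 0] by simp
    then have "omega m v + omega m w \<le> B" using B[OF True] by simp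
    moreover have "0 \<le> omega m v" "0 \<le> omega m w" by (auto simp: omega_def)
    ultimately have "norm v \<le> B" "norm w \<le> B" using om(1)[of v] om(1)[of w] by auto
    then show ?thesis using True by simp
  qed simp
  have "emeasure (Omega m \<star> Omega m) \<Gamma> \<le> (\<integral>\<^sup>+v. ennreal (1 / m) *
      (\<integral>\<^sup>+w. ennreal (1 / m) * (indicator (cball 0 B) v * indicator (cball 0 B) w) \<partial>(lborel :: (real^3) measure)) \<partial>(lborel :: (real^3) measure))"
    unfolding emeasure_convolution_Omega_momenta[OF m \<Gamma>]
    by (intro nn_integral_mono order_trans[OF inner] mult_left_mono ind) auto
  also have "\<dots> = (\<integral>\<^sup>+v. ennreal (1 / m) * (ennreal (1 / m) * emeasure lborel (cball (0 :: real^3) B))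
      * indicator (cball 0 B) v \<partial>(lborel :: (real^3) measure))"
    by (intro nn_integral_cong) (auto simp: nn_integral_cmult_indicator split: split_indicator)
  also have "\<dots> = ennreal (1 / m) * (ennreal (1 / m) * emeasure lborel (cball (0 :: real^3) B))
      * emeasure lborel (cball (0 :: real^3) B)"
    by (rule nn_integral_cmult_indicator) simp
  also have "\<dots> < \<infinity>"
    using emeasure_lborel_cball_finite[of "0 :: real^3" B] by (simp add: ennreal_mult_less_top)
  finally show ?thesis .
qed

theorem mainTheorem5:
  fixes m :: real
  assumes "m > 0"
  shows "(\<forall>\<Gamma> \<in> sets borel. compact (closure \<Gamma>) \<longrightarrow>
            emeasure (Omega m \<star> Omega m) \<Gamma> < \<infinity> \<and>
            emeasure (Omega m \<star> Omega m) \<Gamma> =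
              (\<integral>\<^sup>+ m' \<in> {2 * m..}. ennreal (sigma_spec m m') * emeasure (Omega m') \<Gamma> \<partial>lborel))
         \<and> has_spectrum (Omega m \<star> Omega m) (sigma_spec m)"
proof -
  \<comment> \<open>The domain \<open>A\<close> is left open because the formula integrates over
    \<open>{2 * m..}\<close> and \<open>has_spectrum\<close> over \<open>{0<..}\<close>;
    \<open>sigma_spec\<close> vanishes below \<open>2 * m\<close>.\<close>
  have restrict: "emeasure (Omega m \<star> Omega m) \<Gamma> =
      (\<integral>\<^sup>+ s \<in> A. ennreal (sigma_spec m s) * emeasure (Omega s) \<Gamma> \<partial>lborel)"
    if "\<Gamma> \<in> sets borel" "{2 * m..} \<subseteq> A" for \<Gamma> A
    unfolding emeasure_convolution_Omega_spectrum[OF assms that(1)]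
    using that(2) by (intro nn_integral_cong) (auto simp: sigma_spec_def split: split_indicator)
  have "bounded \<Gamma>" if "compact (closure \<Gamma>)" for \<Gamma> :: "(real^4) set"
    using that by (meson bounded_subset closure_subset compact_imp_bounded)
  moreover have "{2 * m..} \<subseteq> {0<..}" using assms by auto
  ultimately show ?thesis
    unfolding has_spectrum_def
    by (auto intro!: restrict emeasure_convolution_Omega_bounded[OF assms, unfolded infinity_ennreal_def]
        simp: sigma_spec_nonneg[OF assms])
qed

end
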